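(* Let $G$ be a finite simple graph and let $i$ and $j$ be positive integers. Then $G$ is an $\langle i,j\rangle$ competition graph if and only if there is an edge clique cover $\mathcal{C}=\{C_1,\ldots,C_p\}$ of $G$ satisfying all of the following: (i) $|C_t|\le i$ for each $1\le t\le p$; (ii) each vertex of $G$ belongs to at most $j$ cliques in $\mathcal{C}$; (iii) the family $\{V(G)-C_1,\ldots,V(G)-C_p\}$ has a system of distinct representatives; (iv) $p\le |V(G)|$.
   Context: All digraphs are finite, without loops and without parallel arcs; all graphs are finite and simple. The competition graph $C(D)$ of a digraph $D$ has vertex set $V(D)$ and an edge $uv$ ($u\neq v$) if and only if $u$ and $v$ have a common out-neighbor in $D$. For positive integers $i,j$, an $\langle i,j\rangle$ digraph is a loopless digraph in which every vertex $x$ has indegree $d^-(x)\le i$ and outdegree $d^+(x)\le j$ (it need not be acyclic). A graph is an $\langle i,j\rangle$ competition graph if it is the competition graph of some $\langle i,j\rangle$ digraph. A clique is identified with its vertex set; an edge clique cover of $G$ is a collection of cliques of $G$ covering all edges of $G$. A system of distinct representatives (SDR) of a family $\{A_1,\ldots,A_m\}$ of sets is a collection of distinct elements $a_1,\ldots,a_m$ with $a_t\in A_t$ for each $t$. *)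

theory Defs
  imports "Graph_Theory.Pair_Digraph"
begin

text \<open>
  Following the Graph_Theory library, a finite digraph without loops and parallel arcs is a
  \<^locale>\<open>pair_digraph\<close>, and a finite simple graph is a \<^locale>\<open>pair_graph\<close>: a symmetric
  such digraph, in which the edge \<open>uv\<close> is represented by the two arcs \<open>(u, v)\<close> and \<open>(v, u)\<close>.
\<close>

definition competition_graph :: "'a pair_pre_digraph \<Rightarrow> 'a pair_pre_digraph" where
  "competition_graph D =
    \<lparr> pverts = pverts D,
      parcs = {(u, v). u \<in> pverts D \<and> v \<in> pverts D \<and> u \<noteq> v \<and>
        (\<exists>w \<in> pverts D. (u, w) \<in> parcs D \<and> (v, w) \<in> parcs D)} \<rparr>"

definition bounded_digraph :: "nat \<Rightarrow> nat \<Rightarrow> 'a pair_pre_digraph \<Rightarrow> bool" where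
  "bounded_digraph i j D \<longleftrightarrow> pair_digraph D \<and>
    (\<forall>x \<in> pverts D. in_degree (with_proj D) x \<le> i \<and> out_degree (with_proj D) x \<le> j)"

definition bounded_competition_graph :: "nat \<Rightarrow> nat \<Rightarrow> 'a pair_pre_digraph \<Rightarrow> bool" where
  "bounded_competition_graph i j G \<longleftrightarrow> (\<exists>D. bounded_digraph i j D \<and> competition_graph D = G)"

definition clique :: "'a pair_pre_digraph \<Rightarrow> 'a set \<Rightarrow> bool" where
  "clique G K \<longleftrightarrow> K \<subseteq> pverts G \<and> (\<forall>u \<in> K. \<forall>v \<in> K. u \<noteq> v \<longrightarrow> (u, v) \<in> parcs G)"

text \<open>
  Collections of sets are families over an index set \<open>I\<close>, so repeated members are allowed and
  are counted with multiplicity.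
\<close>

definition edge_clique_cover :: "'a pair_pre_digraph \<Rightarrow> 'i set \<Rightarrow> ('i \<Rightarrow> 'a set) \<Rightarrow> bool" where
  "edge_clique_cover G I C \<longleftrightarrow> (\<forall>t \<in> I. clique G (C t)) \<and>
    (\<forall>(u, v) \<in> parcs G. \<exists>t \<in> I. u \<in> C t \<and> v \<in> C t)"

definition has_sdr :: "'i set \<Rightarrow> ('i \<Rightarrow> 'a set) \<Rightarrow> bool" where
  "has_sdr I A \<longleftrightarrow> (\<exists>a. inj_on a I \<and> (\<forall>t \<in> I. a t \<in> A t))"

end

theory Submission
  imports Defs
begin

text \<open>
  The cliques of the cover correspond to the in-neighbourhoods of the digraph. An arc into \<open>w\<close>
  from every vertex of a clique not containing \<open>w\<close> makes that clique compete for \<open>w\<close> without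
  creating a loop, so the system of distinct representatives is an injective choice of prey.
\<close>

lemma in_degree_with_proj: "in_degree (with_proj D) x = card {u. (u, x) \<in> parcs D}"
proof -
  have "in_arcs (with_proj D) x = (\<lambda>u. (u, x)) ` {u. (u, x) \<in> parcs D}"
    by (auto simp: in_arcs_def)
  then show ?thesis
    by (simp add: in_degree_def card_image inj_on_def)
qed

lemma out_degree_with_proj: "out_degree (with_proj D) x = card {w. (x, w) \<in> parcs D}"
proof -
  have "out_arcs (with_proj D) x = Pair x ` {w. (x, w) \<in> parcs D}"
    by (auto simp: out_arcs_def)
  then show ?thesis
    by (simp add: out_degree_def card_image inj_on_def)
qed

text \<open>Taking the in-neighbourhood of every vertex, empty and repeated ones included, gives
  exactly one clique per vertex. Indegrees then bound the clique sizes, outdegrees bound the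
  multiplicities, and each vertex represents the complement of its own in-neighbourhood.\<close>

lemma clique_cover_of_bounded_digraph:
  fixes D :: "'a pair_pre_digraph"
  assumes D: "bounded_digraph i j D"
  obtains C :: "nat \<Rightarrow> 'a set" where
    "edge_clique_cover (competition_graph D) {1..card (pverts D)} C"
    "\<forall>t \<in> {1..card (pverts D)}. card (C t) \<le> i"
    "\<forall>x \<in> pverts D. card {t \<in> {1..card (pverts D)}. x \<in> C t} \<le> j"
    "has_sdr {1..card (pverts D)} (\<lambda>t. pverts D - C t)"
proof -
  interpret pair_digraph D
    using D by (simp add: bounded_digraph_def)
  \<comment> \<open>The enumeration \<open>h\<close> has two uses: it indexes the in-neighbourhoods
    by numbers, and it is itself the system of distinct representatives.\<close>
  obtain h where h: "bij_betw h {1..card (pverts D)} (pverts D)"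
    using ex_bij_betw_nat_finite_1[OF pair_finite_verts] by blast
  let ?I = "{1..card (pverts D)}"
  let ?C = "\<lambda>t. {u. (u, h t) \<in> parcs D}"
  have hV: "h t \<in> pverts D" if "t \<in> ?I" for t
    using bij_betwE[OF h] that by blast
  have onto: "\<exists>t \<in> ?I. h t = w" if "w \<in> pverts D" for w
    using bij_betw_imp_surj_on[OF h] that by (metis imageE)
  have inj: "inj_on h ?I"
    using h by (simp add: bij_betw_def)
  show ?thesis
  proof (rule that[of ?C])
    show "edge_clique_cover (competition_graph D) ?I ?C"
      unfolding edge_clique_cover_def
    proof (intro conjI ballI)
      show "clique (competition_graph D) (?C t)" if "t \<in> ?I" for t
        using hV[OF that] by (auto simp: clique_def competition_graph_def dest: in_arcsD1)
      show "case e of (u, v) \<Rightarrow> \<exists>t \<in> ?I. u \<in> ?C t \<and> v \<in> ?C t"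
        if e: "e \<in> parcs (competition_graph D)" for e
      proof -
        obtain u v w where "e = (u, v)" "w \<in> pverts D" "(u, w) \<in> parcs D" "(v, w) \<in> parcs D"
          using e by (auto simp: competition_graph_def)
        with onto[of w] show ?thesis by blast
      qed
    qed
    show "\<forall>t \<in> ?I. card (?C t) \<le> i"
      using D hV by (auto simp: bounded_digraph_def in_degree_with_proj)
    show "\<forall>x \<in> pverts D. card {t \<in> ?I. x \<in> ?C t} \<le> j"
    proof
      fix x assume x: "x \<in> pverts D"
      have fin: "finite {w. (x, w) \<in> parcs D}"
        by (rule finite_subset[OF _ pair_finite_verts]) (auto dest: in_arcsD2)
      \<comment> \<open>\<open>x \<in> ?C t\<close> says that \<open>h t\<close> is an out-neighbour
        of \<open>x\<close>, so \<open>h\<close> injects these indices into the out-neighbourhood of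
        \<open>x\<close>.\<close>
      have "card {t \<in> ?I. x \<in> ?C t} \<le> card {w. (x, w) \<in> parcs D}"
        by (rule card_inj_on_le[OF _ _ fin, of h]) (auto intro: inj_on_subset[OF inj])
      also have "\<dots> \<le> j"
        using D x by (simp add: bounded_digraph_def out_degree_with_proj)
      finally show "card {t \<in> ?I. x \<in> ?C t} \<le> j" .
    qed
    show "has_sdr ?I (\<lambda>t. pverts D - ?C t)"
      unfolding has_sdr_def
    proof (intro exI conjI ballI)
      \<comment> \<open>\<open>h t \<in> ?C t\<close> would be a loop at \<open>h t\<close>.\<close>
      show "h t \<in> pverts D - ?C t" if "t \<in> ?I" for t
        using hV[OF that] pair_no_loops[of "(h t, h t)"] by auto
    qed (rule inj)
  qed
qed

text \<open>Every vertex of \<open>C t\<close> gets an arc to the representative \<open>a t\<close>.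
  Since \<open>a\<close> is injective, different indices have different prey, so no in-neighbourhood
  merges two cliques: merging could break the indegree bound and create edges outside
  \<open>G\<close>.\<close>

lemma bounded_digraph_of_clique_cover:
  fixes G :: "'a pair_pre_digraph"
  assumes G: "pair_graph G"
    and cover: "edge_clique_cover G I C"
    and fin: "finite I"
    and size: "\<forall>t \<in> I. card (C t) \<le> i"
    and mult: "\<forall>x \<in> pverts G. card {t \<in> I. x \<in> C t} \<le> j"
    and sdr: "has_sdr I (\<lambda>t. pverts G - C t)"
  shows "bounded_competition_graph i j G"
proof -
  interpret pair_graph G by (rule G)
  obtain a where inj: "inj_on a I" and a: "\<And>t. t \<in> I \<Longrightarrow> a t \<in> pverts G \<and> a t \<notin> C t"
    using sdr by (auto simp: has_sdr_def)
  have sub: "u \<in> pverts G" if "t \<in> I" "u \<in> C t" for t u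
    using cover that by (auto simp: edge_clique_cover_def clique_def)
  have adj: "(u, v) \<in> parcs G" if "t \<in> I" "u \<in> C t" "v \<in> C t" "u \<noteq> v" for t u v
    using cover that by (auto simp: edge_clique_cover_def clique_def)
  have cov: "\<exists>t \<in> I. u \<in> C t \<and> v \<in> C t" if "(u, v) \<in> parcs G" for u v
    using cover that by (auto simp: edge_clique_cover_def)
  define A where "A = {(u, a t) | u t. t \<in> I \<and> u \<in> C t}"
  define D where "D = \<lparr>pverts = pverts G, parcs = A\<rparr>"
  have A: "(u, w) \<in> A \<longleftrightarrow> (\<exists>t \<in> I. w = a t \<and> u \<in> C t)" for u w
    by (auto simp: A_def)
  have A_sub: "A \<subseteq> pverts G \<times> pverts G"
    using a sub by (auto simp: A_def)
  have "pair_digraph D"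
  proof
    show "finite (parcs D)"
      using finite_subset[OF A_sub] pair_finite_verts by (simp add: D_def)
    show "finite (pverts D)"
      using pair_finite_verts by (simp add: D_def)
    show "fst e \<in> pverts D" "snd e \<in> pverts D" if "e \<in> parcs D" for e
      using that A_sub by (auto simp: D_def)
    \<comment> \<open>An arc runs from some \<open>u \<in> C t\<close> to \<open>a t\<close>, and
      \<open>a t \<notin> C t\<close>.\<close>
    show "fst e \<noteq> snd e" if "e \<in> parcs D" for e
      using that a by (auto simp: D_def A_def)
  qed
  moreover have "in_degree (with_proj D) x \<le> i" for x
  proof (cases "x \<in> a ` I")
    case True
    then obtain t where t: "t \<in> I" "x = a t" by blast
    then have "{u. (u, x) \<in> parcs D} = C t"
      using inj by (auto simp: D_def A dest: inj_onD)
    then show ?thesis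
      using size t by (simp add: in_degree_with_proj)
  next
    case False
    then have "{u. (u, x) \<in> parcs D} = {}"
      by (auto simp: D_def A)
    then show ?thesis
      by (simp add: in_degree_with_proj)
  qed
  moreover have "out_degree (with_proj D) x \<le> j" if "x \<in> pverts G" for x
  proof -
    \<comment> \<open>Each clique containing \<open>x\<close> contributes one out-neighbour, its
      representative.\<close>
    have "{w. (x, w) \<in> parcs D} = a ` {t \<in> I. x \<in> C t}"
      by (auto simp: D_def A)
    then have "out_degree (with_proj D) x \<le> card {t \<in> I. x \<in> C t}"
      using fin by (simp add: out_degree_with_proj card_image_le)
    also have "\<dots> \<le> j"
      using mult that by blast
    finally show ?thesis .
  qed
  moreover have "competition_graph D = G"
  proof -
    have "(u, v) \<in> parcs G \<longleftrightarrow> u \<in> pverts G \<and> v \<in> pverts G \<and> u \<noteq> v \<and>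
        (\<exists>w \<in> pverts G. (u, w) \<in> A \<and> (v, w) \<in> A)" (is "_ \<longleftrightarrow> ?R") for u v
    proof
      assume uv: "(u, v) \<in> parcs G"
      then obtain t where "t \<in> I" "u \<in> C t" "v \<in> C t"
        using cov by blast
      \<comment> \<open>The common prey is \<open>a t\<close>, for a clique \<open>C t\<close> that
        covers the edge.\<close>
      then show ?R
        using a[of t] sub[of t] pair_no_loops[OF uv] by (auto simp: A)
    next
      assume ?R
      then obtain s t where st: "s \<in> I" "t \<in> I" "a s = a t" "u \<in> C s" "v \<in> C t" and "u \<noteq> v"
        by (auto simp: A)
      \<comment> \<open>A common prey is the representative of a single index, so \<open>u\<close>
        and \<open>v\<close> lie in the same clique and are adjacent in \<open>G\<close>.\<close>
      moreover have "s = t"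
        using inj st by (auto dest: inj_onD)
      ultimately show "(u, v) \<in> parcs G"
        using adj by blast
    qed
    then show ?thesis
      by (intro pair_pre_digraph.equality) (auto simp: competition_graph_def D_def)
  qed
  ultimately show ?thesis
    by (auto simp: bounded_competition_graph_def bounded_digraph_def D_def)
qed

theorem theorem2p2:
  fixes G :: "'a pair_pre_digraph" and i j :: nat
  assumes "pair_graph G" and "i \<ge> 1" and "j \<ge> 1"
  shows "bounded_competition_graph i j G \<longleftrightarrow>
    (\<exists>(p::nat) (C :: nat \<Rightarrow> 'a set).
      edge_clique_cover G {1..p} C \<and>
      (\<forall>t \<in> {1..p}. card (C t) \<le> i) \<and>
      (\<forall>x \<in> pverts G. card {t \<in> {1..p}. x \<in> C t} \<le> j) \<and>
      has_sdr {1..p} (\<lambda>t. pverts G - C t) \<and>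
      p \<le> card (pverts G))"
    (is "_ \<longleftrightarrow> ?R")
proof
  assume "bounded_competition_graph i j G"
  then obtain D where D: "bounded_digraph i j D" and DG: "competition_graph D = G"
    by (auto simp: bounded_competition_graph_def)
  \<comment> \<open>The cover is built from \<open>D\<close>; equal vertex sets carry its
    complements and the bound on \<open>p\<close> over to \<open>G\<close>.\<close>
  have VG: "pverts G = pverts D"
    by (simp add: competition_graph_def flip: DG)
  obtain C :: "nat \<Rightarrow> 'a set" where
    "edge_clique_cover G {1..card (pverts G)} C"
    "\<forall>t \<in> {1..card (pverts G)}. card (C t) \<le> i"
    "\<forall>x \<in> pverts G. card {t \<in> {1..card (pverts G)}. x \<in> C t} \<le> j"
    "has_sdr {1..card (pverts G)} (\<lambda>t. pverts G - C t)"
    using clique_cover_of_bounded_digraph[OF D] unfolding DG VG by blast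
  then show ?R
    by (intro exI[of _ "card (pverts G)"] exI[of _ C] conjI order_refl)
next
  assume ?R
  then show "bounded_competition_graph i j G"
    by (elim exE conjE) (rule bounded_digraph_of_clique_cover[OF assms(1) _ finite_atLeastAtMost])
qed

end
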